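(* Let $\mathcal E_{\mathrm{sim}}=\sigma_x^u\circ\mathcal E_\eta\circ\mathcal E_P$, where $u\in\{0,1\}$, $\mathcal E_\eta$ is the amplitude damping channel with parameter $\eta\in[0,1]$, and $\mathcal E_P$ is the Pauli channel with parameters $(q_1,q_2,q_3)\in\mathcal T$. Then the trace norm distance between $\mathcal E_{\mathrm{sim}}$ and the closest Pauli channel $\mathcal E_{\mathrm{cl}}$ is $\eta$. Moreover, the closest Pauli channel is $\mathcal E_{\mathrm{cl}}:(x,y,z)\mapsto(f_{11}x,f_{22}y,f_{33}z)$ with $$(f_{11},f_{22},f_{33})=\begin{cases}\big(\sqrt{1-\eta}\,q_1,\,-\sqrt{1-\eta}\,q_2,\,(1-\eta)q_3\big)&\text{for }u=0,\\ \big(\sqrt{1-\eta}\,q_1,\,\sqrt{1-\eta}\,q_2,\,-(1-\eta)q_3\big)&\text{for }u=1.\end{cases}$$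
   Context: The Bloch vector $(x,y,z)$ of a qubit state $\rho$ is defined by $\rho=\frac12(I+x\sigma_x+y\sigma_y+z\sigma_z)$, and qubit channels are described by their action on Bloch vectors. In compositions, $\sigma_x$ denotes the unitary channel $\rho\mapsto\sigma_x\rho\sigma_x^\dagger$. The amplitude damping channel $\mathcal E_\eta$ acts as $(x,y,z)\mapsto(\sqrt{1-\eta}\,x,\sqrt{1-\eta}\,y,\eta+(1-\eta)z)$. $\mathcal T$ is the tetrahedron with vertices $(1,-1,1),(1,1,-1),(-1,-1,-1),(-1,1,1)$ (convex hull). The Pauli channels are exactly the channels $\rho\mapsto\sum_{i=0}^3p_i\sigma_i\rho\sigma_i$ with $(p_i)$ a probability distribution and $(\sigma_0,\dots,\sigma_3)=(I,\sigma_x,\sigma_y,\sigma_z)$; equivalently, they act as $(x,y,z)\mapsto(c_1x,-c_2y,c_3z)$ with parameters $(c_1,c_2,c_3)\in\mathcal T$. The trace norm distance between two channels is $\|\mathcal E_1-\mathcal E_2\|_1:=\sup_\rho\|\mathcal E_1(\rho)-\mathcal E_2(\rho)\|_1$, the supremum being over input states $\rho$ (here single-qubit states), with $\|\sigma\|_1=\mathrm{Tr}\sqrt{\sigma\sigma^\dagger}$. *)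

theory Defs
  imports "HOL-Analysis.Analysis"
begin

type_synonym qubit_op = "complex^2^2"

definition dagger :: "complex^'n^'m \<Rightarrow> complex^'m^'n" where
  "dagger A = (\<chi> i j. cnj (A $ j $ i))"

definition pos_semidef :: "complex^'n^'n \<Rightarrow> bool" where
  "pos_semidef A \<longleftrightarrow>
     dagger A = A \<and> (\<forall>v. 0 \<le> Re (\<Sum>i\<in>UNIV. cnj (v $ i) * (A *v v) $ i))"

definition psd_sqrt :: "complex^'n^'n \<Rightarrow> complex^'n^'n" where
  "psd_sqrt A = (THE B. pos_semidef B \<and> B ** B = A)"

definition trace_norm :: "complex^'n^'n \<Rightarrow> real" where
  "trace_norm A = Re (trace (psd_sqrt (A ** dagger A)))"

definition qubit_state :: "qubit_op \<Rightarrow> bool" where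
  "qubit_state \<rho> \<longleftrightarrow> pos_semidef \<rho> \<and> trace \<rho> = 1"

definition sigma_x :: qubit_op where
  "sigma_x = vector [vector [0, 1], vector [1, 0]]"

definition sigma_y :: qubit_op where
  "sigma_y = vector [vector [0, - \<i>], vector [\<i>, 0]]"

definition sigma_z :: qubit_op where
  "sigma_z = vector [vector [1, 0], vector [0, - 1]]"

definition pauli_matrix :: "nat \<Rightarrow> qubit_op" where
  "pauli_matrix i = [mat 1, sigma_x, sigma_y, sigma_z] ! i"

definition bloch_op :: "real \<times> real \<times> real \<Rightarrow> qubit_op" where
  "bloch_op = (\<lambda>(x, y, z).
     (1/2) *\<^sub>R (mat 1 + x *\<^sub>R sigma_x + y *\<^sub>R sigma_y + z *\<^sub>R sigma_z))"

definition bloch_vector :: "qubit_op \<Rightarrow> real \<times> real \<times> real" where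
  "bloch_vector \<rho> = (THE r. \<rho> = bloch_op r)"

text \<open>A qubit channel is represented by a function on all 2-by-2 matrices, of which only the
  restriction to states is meaningful: \<open>bloch_vector\<close> is unspecified on operators that are not
  Hermitian of trace one. Channels are therefore compared with \<open>same_channel\<close>, never with
  equality of functions.\<close>

definition same_channel :: "(qubit_op \<Rightarrow> qubit_op) \<Rightarrow> (qubit_op \<Rightarrow> qubit_op) \<Rightarrow> bool" where
  "same_channel E F \<longleftrightarrow> (\<forall>\<rho>. qubit_state \<rho> \<longrightarrow> E \<rho> = F \<rho>)"

definition bloch_channel ::
    "(real \<times> real \<times> real \<Rightarrow> real \<times> real \<times> real) \<Rightarrow> qubit_op \<Rightarrow> qubit_op" where
  "bloch_channel f \<rho> = bloch_op (f (bloch_vector \<rho>))"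

definition unitary_channel :: "qubit_op \<Rightarrow> qubit_op \<Rightarrow> qubit_op" where
  "unitary_channel U \<rho> = U ** \<rho> ** dagger U"

definition amplitude_damping :: "real \<Rightarrow> qubit_op \<Rightarrow> qubit_op" where
  "amplitude_damping \<eta> = bloch_channel (\<lambda>(x, y, z).
     (sqrt (1 - \<eta>) * x, sqrt (1 - \<eta>) * y, \<eta> + (1 - \<eta>) * z))"

definition pauli_channel :: "(qubit_op \<Rightarrow> qubit_op) \<Rightarrow> bool" where
  "pauli_channel E \<longleftrightarrow> (\<exists>p :: nat \<Rightarrow> real. (\<forall>i<4. 0 \<le> p i) \<and> (\<Sum>i<4. p i) = 1 \<and>
     same_channel E (\<lambda>\<rho>. \<Sum>i<4. p i *\<^sub>R (pauli_matrix i ** \<rho> ** pauli_matrix i)))"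

definition tetrahedron :: "(real \<times> real \<times> real) set" where
  "tetrahedron = convex hull {(1, -1, 1), (1, 1, -1), (-1, -1, -1), (-1, 1, 1)}"

definition pauli_with_params :: "real \<times> real \<times> real \<Rightarrow> qubit_op \<Rightarrow> qubit_op" where
  "pauli_with_params = (\<lambda>(c1, c2, c3).
     bloch_channel (\<lambda>(x, y, z). (c1 * x, - c2 * y, c3 * z)))"

text \<open>For maps that send states to states, the set below is bounded above by 2, so the
  supremum in the reals is the intended one.\<close>

definition channel_dist :: "(qubit_op \<Rightarrow> qubit_op) \<Rightarrow> (qubit_op \<Rightarrow> qubit_op) \<Rightarrow> real" where
  "channel_dist E F = (SUP \<rho>\<in>{\<rho>. qubit_state \<rho>}. trace_norm (E \<rho> - F \<rho>))"

definition closest_pauli_channel ::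
    "(qubit_op \<Rightarrow> qubit_op) \<Rightarrow> (qubit_op \<Rightarrow> qubit_op) \<Rightarrow> bool" where
  "closest_pauli_channel E P \<longleftrightarrow>
     pauli_channel P \<and> (\<forall>Q. pauli_channel Q \<longrightarrow> channel_dist E P \<le> channel_dist E Q)"

end

theory Submission
  imports Defs
begin

text \<open>On Bloch vectors, the difference between the simulated channel and a Pauli channel is
  \<open>(x, y, z) \<mapsto> (d1 x, d2 y, d3 z \<plusminus> \<eta>)\<close>, and the trace norm is the Euclidean length.
  The inputs \<open>(0, 0, \<plusminus>1)\<close> force the distance to be at least \<open>\<eta> + \<bar>d3\<bar>\<close>, and
  \<open>(1, 0, 0)\<close>, \<open>(0, 1, 0)\<close> force it above \<open>\<eta>\<close> unless \<open>d1 = d2 = 0\<close>. The choice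
  \<open>d = 0\<close> gives \<open>\<eta>\<close>; it is attained by a Pauli channel because
  \<open>(s, s, s\<^sup>2)\<close> with \<open>s = sqrt (1 - \<eta>)\<close> are the multipliers of one, and Pauli
  channels compose by convolution of their distributions on the Klein four-group.\<close>

section \<open>Hermitian 2-by-2 matrices: positivity and square roots\<close>

lemma cmod_square: "(cmod z)\<^sup>2 = Re z * Re z + Im z * Im z"
  by (simp add: cmod_power2 power2_eq_square[of "Re z"] power2_eq_square[of "Im z"])

lemmas matrix2_simps = vec_eq_iff forall_2 matrix_matrix_mult_def matrix_vector_mult_def
  sum_2 dagger_def mat_def trace_def

definition hermitian2 :: "real \<Rightarrow> real \<Rightarrow> complex \<Rightarrow> qubit_op" where
  "hermitian2 a d b = vector [vector [of_real a, b], vector [cnj b, of_real d]]"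

lemma hermitian2_nth [simp]:
  "hermitian2 a d b $ 1 $ 1 = of_real a" "hermitian2 a d b $ 1 $ 2 = b"
  "hermitian2 a d b $ 2 $ 1 = cnj b" "hermitian2 a d b $ 2 $ 2 = of_real d"
  by (simp_all add: hermitian2_def vector_2)

lemma hermitian2_exhaust:
  assumes "dagger A = A"
  obtains a d b where "A = hermitian2 a d b"
proof -
  have "cnj (A $ 1 $ 1) = A $ 1 $ 1" "cnj (A $ 2 $ 2) = A $ 2 $ 2" "A $ 2 $ 1 = cnj (A $ 1 $ 2)"
    using assms by (simp_all add: matrix2_simps)
  then have "A = hermitian2 (Re (A $ 1 $ 1)) (Re (A $ 2 $ 2)) (A $ 1 $ 2)"
    by (simp add: vec_eq_iff forall_2 complex_eq_iff)
  then show thesis by (rule that)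
qed

lemma dagger_hermitian2 [simp]: "dagger (hermitian2 a d b) = hermitian2 a d b"
  by (simp add: matrix2_simps)

lemma quadratic_form_hermitian2:
  "Re (\<Sum>i\<in>UNIV. cnj (v $ i) * (hermitian2 a d b *v v) $ i) =
    a * (cmod (v $ 1))\<^sup>2 + d * (cmod (v $ 2))\<^sup>2 + 2 * Re (cnj (v $ 1) * b * v $ 2)"
  by (simp add: matrix2_simps cmod_square algebra_simps)

text \<open>The determinant criterion for semidefiniteness. Necessity comes from well-chosen test
  vectors, sufficiency from completing the square.\<close>

lemma pos_semidef_hermitian2:
  "pos_semidef (hermitian2 a d b) \<longleftrightarrow> 0 \<le> a \<and> 0 \<le> d \<and> (cmod b)\<^sup>2 \<le> a * d"
proof
  assume "pos_semidef (hermitian2 a d b)"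
  then have *: "0 \<le> a * (cmod x)\<^sup>2 + d * (cmod y)\<^sup>2 + 2 * Re (cnj x * b * y)" for x y
    unfolding pos_semidef_def quadratic_form_hermitian2
    by (elim conjE allE[of _ "vector [x, y]"]) (simp add: vector_2)
  have a: "0 \<le> a" using *[of 1 0] by simp
  have d: "0 \<le> d" using *[of 0 1] by simp
  \<comment> \<open>The vector \<open>(-b, a)\<close> is annihilated by the first row, so the form
    there is \<open>a\<close> times the determinant; \<open>(d, - cnj b)\<close> does the same for
    the second row.\<close>
  have 1: "0 \<le> a * (a * d - (cmod b)\<^sup>2)"
    using *[of "- b" "of_real a"]
    by (simp add: cmod_square power2_eq_square[of a] algebra_simps)
  have 2: "0 \<le> d * (a * d - (cmod b)\<^sup>2)"
    using *[of "of_real d" "- cnj b"]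
    by (simp add: cmod_square power2_eq_square[of d] algebra_simps)
  \<comment> \<open>When both diagonal entries vanish, the two bounds above are void; this one then
    forces \<open>b = 0\<close>.\<close>
  have 3: "0 \<le> a * (cmod b)\<^sup>2 + d - 2 * (cmod b)\<^sup>2"
    using *[of b "- 1"] by (simp add: cmod_square algebra_simps)
  have "(cmod b)\<^sup>2 \<le> a * d"
  proof (cases "a = 0 \<and> d = 0")
    case True
    then show ?thesis using 3 by simp
  next
    case False
    then show ?thesis using 1 2 a d by (auto simp: zero_le_mult_iff)
  qed
  then show "0 \<le> a \<and> 0 \<le> d \<and> (cmod b)\<^sup>2 \<le> a * d" using a d by simp
next
  assume asm: "0 \<le> a \<and> 0 \<le> d \<and> (cmod b)\<^sup>2 \<le> a * d"
  have "0 \<le> a * (cmod x)\<^sup>2 + d * (cmod y)\<^sup>2 + 2 * Re (cnj x * b * y)" for x y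
  proof (cases "a = 0")
    case True
    then have "b = 0" using asm by simp
    then show ?thesis using asm by simp
  next
    case False
    have "a * (a * (cmod x)\<^sup>2 + d * (cmod y)\<^sup>2 + 2 * Re (cnj x * b * y)) =
        (cmod (of_real a * x + b * y))\<^sup>2 + (a * d - (cmod b)\<^sup>2) * (cmod y)\<^sup>2"
      by (simp add: cmod_square algebra_simps)
    also have "\<dots> \<ge> 0" using asm by simp
    finally show ?thesis using False asm by (simp add: zero_le_mult_iff)
  qed
  then show "pos_semidef (hermitian2 a d b)"
    unfolding pos_semidef_def quadratic_form_hermitian2 by simp
qed

text \<open>Scalar matrices suffice for the trace norm here, since a traceless Hermitian 2-by-2
  matrix squares to a scalar. For uniqueness, the off-diagonal entry of \<open>B ** B\<close> is
  \<open>(a + d) * b\<close>: either \<open>b = 0\<close> directly, or the trace vanishes and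
  positivity gives \<open>b = 0\<close>. The diagonal entries are then nonnegative roots.\<close>

lemma psd_sqrt_scalar:
  assumes c: "0 \<le> c"
  shows "psd_sqrt (hermitian2 (c\<^sup>2) (c\<^sup>2) 0) = hermitian2 c c 0"
  unfolding psd_sqrt_def
proof (rule the_equality)
  show "pos_semidef (hermitian2 c c 0) \<and>
      hermitian2 c c 0 ** hermitian2 c c 0 = hermitian2 (c\<^sup>2) (c\<^sup>2) 0"
    using c by (simp add: pos_semidef_hermitian2 matrix2_simps power2_eq_square)
next
  fix B :: qubit_op
  assume B: "pos_semidef B \<and> B ** B = hermitian2 (c\<^sup>2) (c\<^sup>2) 0"
  then obtain a d b where Beq: "B = hermitian2 a d b"
    unfolding pos_semidef_def by (metis hermitian2_exhaust)
  have a: "0 \<le> a" and d: "0 \<le> d" and b: "(cmod b)\<^sup>2 \<le> a * d"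
    using B by (simp_all add: Beq pos_semidef_hermitian2)
  have "complex_of_real a * of_real a + b * cnj b = (of_real c)\<^sup>2"
    and "complex_of_real a * b + b * of_real d = 0"
    and "cnj b * b + complex_of_real d * of_real d = (of_real c)\<^sup>2"
    using B by (simp_all add: Beq matrix2_simps)
  then have 1: "a\<^sup>2 + (cmod b)\<^sup>2 = c\<^sup>2" and 2: "(complex_of_real (a + d)) * b = 0"
    and 3: "d\<^sup>2 + (cmod b)\<^sup>2 = c\<^sup>2"
    by (simp_all add: complex_eq_iff cmod_square power2_eq_square[of a] power2_eq_square[of d]
        power2_eq_square[of c] power2_eq_square[of "complex_of_real c"] algebra_simps)
  have "b = 0"
  proof (cases "a + d = 0")
    case True
    then have "a = 0" using a d by simp
    then show ?thesis using b by simp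
  next
    case False
    then show ?thesis using 2 by (simp only: mult_eq_0_iff of_real_eq_0_iff simp_thms)
  qed
  then show "B = hermitian2 c c 0"
    using 1 3 a d c by (simp add: Beq power2_eq_iff_nonneg)
qed

section \<open>Bloch vectors, states and the trace norm\<close>

lemma bloch_op_eq:
  "bloch_op (x, y, z) = hermitian2 ((1 + z) / 2) ((1 - z) / 2) (Complex (x / 2) (- y / 2))"
  by (simp add: bloch_op_def matrix2_simps sigma_x_def sigma_y_def sigma_z_def vector_2
      complex_eq_iff)

lemma bloch_op_inject: "bloch_op r = bloch_op r' \<longleftrightarrow> r = r'"
  by (cases r; cases r') (auto simp: bloch_op_eq vec_eq_iff forall_2 complex_eq_iff)

lemma bloch_vector_bloch_op [simp]: "bloch_vector (bloch_op r) = r"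
  unfolding bloch_vector_def by (rule the_equality) (simp_all add: bloch_op_inject)

lemma bloch_channel_bloch_op [simp]: "bloch_channel f (bloch_op r) = bloch_op (f r)"
  by (simp add: bloch_channel_def)

text \<open>The determinant is a quarter of one minus the squared length. Membership in the ball
  also gives \<bar>z\<bar> \<le> 1, hence a nonnegative diagonal.\<close>

lemma qubit_state_bloch_op:
  "qubit_state (bloch_op (x, y, z)) \<longleftrightarrow> x\<^sup>2 + y\<^sup>2 + z\<^sup>2 \<le> 1"
proof -
  have "z\<^sup>2 \<le> 1" if "x\<^sup>2 + y\<^sup>2 + z\<^sup>2 \<le> 1"
    using that zero_le_power2[of x] zero_le_power2[of y] by linarith
  then have "\<bar>z\<bar> \<le> 1" if "x\<^sup>2 + y\<^sup>2 + z\<^sup>2 \<le> 1"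
    using that by (simp add: abs_square_le_1)
  then show ?thesis
    by (auto simp: qubit_state_def bloch_op_eq pos_semidef_hermitian2 trace_def sum_2 cmod_square
        power2_eq_square[of x] power2_eq_square[of y] power2_eq_square[of z] field_simps
        complex_eq_iff abs_le_iff)
qed

lemma qubit_state_exhaust:
  assumes "qubit_state \<rho>"
  obtains x y z where "\<rho> = bloch_op (x, y, z)" "x\<^sup>2 + y\<^sup>2 + z\<^sup>2 \<le> 1"
proof -
  obtain a d b where \<rho>: "\<rho> = hermitian2 a d b"
    using assms unfolding qubit_state_def pos_semidef_def by (metis hermitian2_exhaust)
  have "a + d = 1"
    using assms by (simp add: qubit_state_def \<rho> trace_def sum_2 complex_eq_iff)
  then have "\<rho> = bloch_op (2 * Re b, - 2 * Im b, a - d)"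
    by (simp add: \<rho> bloch_op_eq vec_eq_iff forall_2 complex_eq_iff field_simps)
  then show thesis using that assms qubit_state_bloch_op by metis
qed

lemma trace_norm_bloch_diff:
  "trace_norm (bloch_op (x, y, z) - bloch_op (x', y', z')) =
    sqrt ((x - x')\<^sup>2 + (y - y')\<^sup>2 + (z - z')\<^sup>2)"
proof -
  \<comment> \<open>The difference is Hermitian and traceless, with eigenvalues c and -c, so its
    square is the scalar matrix with entry \<open>c\<^sup>2\<close>.\<close>
  define c where "c = sqrt ((x - x')\<^sup>2 + (y - y')\<^sup>2 + (z - z')\<^sup>2) / 2"
  define A where "A = bloch_op (x, y, z) - bloch_op (x', y', z')"
  have "0 \<le> c" and c2: "c\<^sup>2 = ((x - x')\<^sup>2 + (y - y')\<^sup>2 + (z - z')\<^sup>2) / 4"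
    by (simp_all add: c_def power_divide)
  have A: "A = hermitian2 ((z - z') / 2) (- (z - z') / 2)
      (Complex ((x - x') / 2) (- (y - y') / 2))"
    by (simp add: A_def bloch_op_eq vec_eq_iff forall_2 complex_eq_iff field_simps)
  have "A ** dagger A = hermitian2 (c\<^sup>2) (c\<^sup>2) 0"
    unfolding A c2 dagger_hermitian2
    by (simp add: vec_eq_iff forall_2 matrix_matrix_mult_def sum_2 complex_eq_iff
        power2_eq_square field_simps)
  then have "trace_norm A = 2 * c"
    using \<open>0 \<le> c\<close> by (simp add: trace_norm_def psd_sqrt_scalar trace_def sum_2)
  then show ?thesis by (simp add: A_def c_def)
qed

section \<open>Pauli channels as diagonal maps of Bloch vectors\<close>

lemma unitary_channel_sigma_x_bloch_op:
  "unitary_channel sigma_x (bloch_op (x, y, z)) = bloch_op (x, - y, - z)"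
  by (simp add: unitary_channel_def bloch_op_eq matrix2_simps sigma_x_def vector_2
      complex_eq_iff)

text \<open>Conjugation by a Pauli matrix fixes its own Bloch component and negates the other two;
  normalisation of \<open>p\<close> preserves the identity component.\<close>

lemma pauli_sum_bloch_op:
  assumes "(\<Sum>i<4. p i) = 1"
  shows "(\<Sum>i<4. p i *\<^sub>R (pauli_matrix i ** bloch_op (x, y, z) ** pauli_matrix i)) =
    bloch_op ((p 0 + p 1 - p 2 - p 3) * x, (p 0 - p 1 + p 2 - p 3) * y,
      (p 0 - p 1 - p 2 + p 3) * z)"
proof -
  have p0: "p 0 = 1 - p 1 - p 2 - p 3"
    using assms by (simp add: eval_nat_numeral)
  have S: "(\<Sum>i<4. g i) = g 0 + g 1 + g 2 + g 3" for g :: "nat \<Rightarrow> qubit_op"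
    by (simp add: eval_nat_numeral)
  have nth: "pauli_matrix 0 = mat 1" "pauli_matrix 1 = sigma_x" "pauli_matrix 2 = sigma_y"
    "pauli_matrix 3 = sigma_z"
    by (simp_all add: pauli_matrix_def)
  show ?thesis
    unfolding S nth p0
    by (simp add: bloch_op_eq matrix2_simps sigma_x_def sigma_y_def sigma_z_def vector_2
        complex_eq_iff) (simp add: field_simps)
qed

definition diag_channel :: "real \<Rightarrow> real \<Rightarrow> real \<Rightarrow> qubit_op \<Rightarrow> qubit_op" where
  "diag_channel a b c = bloch_channel (\<lambda>(x, y, z). (a * x, b * y, c * z))"

lemma diag_channel_bloch_op [simp]:
  "diag_channel a b c (bloch_op (x, y, z)) = bloch_op (a * x, b * y, c * z)"
  by (simp add: diag_channel_def)

lemma pauli_channel_imp_diag: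
  assumes "pauli_channel E"
  obtains a b c where "same_channel E (diag_channel a b c)"
proof -
  obtain p :: "nat \<Rightarrow> real" where p: "(\<Sum>i<4. p i) = 1"
    "same_channel E (\<lambda>\<rho>. \<Sum>i<4. p i *\<^sub>R (pauli_matrix i ** \<rho> ** pauli_matrix i))"
    using assms unfolding pauli_channel_def by blast
  have "same_channel E (diag_channel (p 0 + p 1 - p 2 - p 3) (p 0 - p 1 + p 2 - p 3)
      (p 0 - p 1 - p 2 + p 3))"
    unfolding same_channel_def
  proof (intro allI impI)
    fix \<rho> :: qubit_op
    assume state: "qubit_state \<rho>"
    then obtain x y z where \<rho>: "\<rho> = bloch_op (x, y, z)"
      by (blast elim: qubit_state_exhaust)
    have "E \<rho> = (\<Sum>i<4. p i *\<^sub>R (pauli_matrix i ** \<rho> ** pauli_matrix i))"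
      using p(2) state by (simp only: same_channel_def)
    then show "E \<rho> = diag_channel (p 0 + p 1 - p 2 - p 3) (p 0 - p 1 + p 2 - p 3)
        (p 0 - p 1 - p 2 + p 3) \<rho>"
      unfolding \<rho> pauli_sum_bloch_op[OF p(1)] by simp
  qed
  then show thesis by (rule that)
qed

lemma pauli_channel_diagI:
  assumes "0 \<le> 1 + a + b + c" "0 \<le> 1 + a - b - c" "0 \<le> 1 - a + b - c" "0 \<le> 1 - a - b + c"
  shows "pauli_channel (diag_channel a b c)"
proof -
  \<comment> \<open>Solution of the linear system given by the three multipliers and normalisation;
    the hypotheses say that these four weights are nonnegative.\<close>
  define p where "p i = [(1 + a + b + c) / 4, (1 + a - b - c) / 4, (1 - a + b - c) / 4,
    (1 - a - b + c) / 4] ! i" for i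
  have p: "p 0 = (1 + a + b + c) / 4" "p 1 = (1 + a - b - c) / 4" "p 2 = (1 - a + b - c) / 4"
    "p 3 = (1 - a - b + c) / 4"
    by (simp_all add: p_def)
  have s: "(\<Sum>i<4. p i) = p 0 + p 1 + p 2 + p 3"
    by (simp add: eval_nat_numeral)
  have sum1: "(\<Sum>i<4. p i) = 1"
    unfolding s p by (simp add: field_simps)
  have "\<forall>i<4. 0 \<le> p i"
  proof (intro allI impI)
    fix i :: nat
    assume "i < 4"
    then consider "i = 0" | "i = 1" | "i = 2" | "i = 3" by linarith
    then show "0 \<le> p i" using assms by cases (simp_all only: p divide_nonneg_pos zero_less_numeral)
  qed
  moreover have "same_channel (diag_channel a b c)
      (\<lambda>\<rho>. \<Sum>i<4. p i *\<^sub>R (pauli_matrix i ** \<rho> ** pauli_matrix i))"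
    unfolding same_channel_def
  proof (intro allI impI)
    fix \<rho> :: qubit_op
    assume "qubit_state \<rho>"
    then obtain x y z where \<rho>: "\<rho> = bloch_op (x, y, z)"
      by (blast elim: qubit_state_exhaust)
    have "p 0 + p 1 - p 2 - p 3 = a" "p 0 - p 1 + p 2 - p 3 = b" "p 0 - p 1 - p 2 + p 3 = c"
      unfolding p by (simp_all add: field_simps)
    then show "diag_channel a b c \<rho> =
        (\<Sum>i<4. p i *\<^sub>R (pauli_matrix i ** \<rho> ** pauli_matrix i))"
      unfolding \<rho> pauli_sum_bloch_op[OF sum1] by simp
  qed
  ultimately show ?thesis using sum1 unfolding pauli_channel_def by blast
qed

text \<open>Each inequality is the half-space of one face, so by convexity it need only be checked
  at the vertices. With multipliers \<open>(x, -y, z)\<close> these are the hypotheses of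
  \<open>pauli_channel_diagI\<close>.\<close>

lemma tetrahedron_halfspaces:
  assumes "(x, y, z) \<in> tetrahedron"
  shows "0 \<le> 1 + x - y + z" "0 \<le> 1 + x + y - z" "0 \<le> 1 - x - y - z" "0 \<le> 1 - x + y + z"
proof -
  have halfspace: "tetrahedron \<subseteq> {r. - 1 \<le> (k1, k2, k3) \<bullet> r}"
    if "- 1 \<le> k1 - k2 + k3" "- 1 \<le> k1 + k2 - k3" "- 1 \<le> - k1 - k2 - k3" "- 1 \<le> - k1 + k2 + k3"
    for k1 k2 k3 :: real
    unfolding tetrahedron_def
    by (rule hull_minimal) (use that in \<open>auto simp: convex_halfspace_ge\<close>)
  show "0 \<le> 1 + x - y + z" "0 \<le> 1 + x + y - z" "0 \<le> 1 - x - y - z" "0 \<le> 1 - x + y + z"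
    using assms halfspace[of 1 "- 1" 1] halfspace[of 1 1 "- 1"] halfspace[of "- 1" "- 1" "- 1"]
      halfspace[of "- 1" 1 1]
    by auto
qed

lemma pauli_channel_damped:
  assumes q: "0 \<le> 1 + a + b + c" "0 \<le> 1 + a - b - c" "0 \<le> 1 - a + b - c" "0 \<le> 1 - a - b + c"
    and s: "0 \<le> s" "s \<le> 1"
  shows "pauli_channel (diag_channel (s * a) (s * b) (s\<^sup>2 * c))"
proof -
  \<comment> \<open>The coefficients are four times the probabilities of the Pauli channel with
    multipliers \<open>(s, s, s\<^sup>2)\<close>.\<close>
  have nonneg: "0 \<le> (1 + s)\<^sup>2 * t0 + (1 - s\<^sup>2) * t1 + (1 - s\<^sup>2) * t2 + (1 - s)\<^sup>2 * t3"
    if "0 \<le> t0" "0 \<le> t1" "0 \<le> t2" "0 \<le> t3" for t0 t1 t2 t3 :: real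
    using that s by (intro add_nonneg_nonneg mult_nonneg_nonneg) (auto simp: power_le_one)
  show ?thesis
    \<comment> \<open>The index permutations are the translations of the Klein four-group; each
      instance is four times one required inequality.\<close>
    by (rule pauli_channel_diagI)
      (use nonneg[OF q] nonneg[OF q(2,1,4,3)] nonneg[OF q(3,4,1,2)] nonneg[OF q(4,3,2,1)]
        in \<open>simp_all add: power2_eq_square algebra_simps\<close>)
qed

section \<open>Distance from a shifted diagonal map to Pauli channels\<close>

lemma same_channel_channel_dist:
  assumes "same_channel F G"
  shows "channel_dist E F = channel_dist E G"
  unfolding channel_dist_def
  by (rule SUP_cong) (use assms in \<open>auto simp: same_channel_def\<close>)

lemma same_channel_pauli:
  assumes "same_channel F G" "pauli_channel G"
  shows "pauli_channel F"
proof -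
  obtain p :: "nat \<Rightarrow> real" where "\<forall>i<4. 0 \<le> p i" "(\<Sum>i<4. p i) = 1"
    "same_channel G (\<lambda>\<rho>. \<Sum>i<4. p i *\<^sub>R (pauli_matrix i ** \<rho> ** pauli_matrix i))"
    using assms(2) unfolding pauli_channel_def by blast
  moreover from this(3) assms(1)
  have "same_channel F (\<lambda>\<rho>. \<Sum>i<4. p i *\<^sub>R (pauli_matrix i ** \<rho> ** pauli_matrix i))"
    by (simp add: same_channel_def)
  ultimately show ?thesis unfolding pauli_channel_def by blast
qed

text \<open>Common form of the simulated channel for both values of \<open>u\<close>: damping leaves
  a translation along the z axis, whose sign \<open>sigma_x\<close> reverses.\<close>

definition shifted_diag_channel :: "real \<Rightarrow> real \<Rightarrow> real \<Rightarrow> real \<Rightarrow> qubit_op \<Rightarrow> qubit_op" where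
  "shifted_diag_channel t a b c = bloch_channel (\<lambda>(x, y, z). (a * x, b * y, c * z + t))"

lemma trace_norm_shifted_diag_diff:
  "trace_norm (shifted_diag_channel t a b c (bloch_op (x, y, z)) -
      diag_channel a' b' c' (bloch_op (x, y, z))) =
    sqrt (((a - a') * x)\<^sup>2 + ((b - b') * y)\<^sup>2 + ((c - c') * z + t)\<^sup>2)"
  by (simp add: shifted_diag_channel_def trace_norm_bloch_diff algebra_simps)

text \<open>With equal multipliers the outputs differ by the same translation for every input, so
  the supremum is over a constant.\<close>

lemma channel_dist_shifted_diag_same:
  "channel_dist (shifted_diag_channel t a b c) (diag_channel a b c) = \<bar>t\<bar>"
proof -
  have eq: "trace_norm (shifted_diag_channel t a b c \<rho> - diag_channel a b c \<rho>) = \<bar>t\<bar>"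
    if state: "\<rho> \<in> {\<rho>. qubit_state \<rho>}" for \<rho>
  proof -
    obtain x y z where "\<rho> = bloch_op (x, y, z)"
      using state by (blast elim: qubit_state_exhaust)
    then show ?thesis
      by (simp add: trace_norm_shifted_diag_diff del: diag_channel_bloch_op)
  qed
  have "qubit_state (bloch_op (0, 0, 0))"
    by (simp add: qubit_state_bloch_op)
  then have "{\<rho>. qubit_state \<rho>} \<noteq> {}" by blast
  then have "(SUP \<rho>\<in>{\<rho>. qubit_state \<rho>}. \<bar>t\<bar>) = \<bar>t\<bar>" by (rule cSUP_const)
  moreover have "channel_dist (shifted_diag_channel t a b c) (diag_channel a b c) =
      (SUP \<rho>\<in>{\<rho>. qubit_state \<rho>}. \<bar>t\<bar>)"
    unfolding channel_dist_def by (rule SUP_cong[OF refl eq])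
  ultimately show ?thesis by simp
qed

text \<open>Every point of the Bloch ball gives a lower bound for the supremum, once the set of
  values is known to be bounded above.\<close>

lemma channel_dist_shifted_diag_ge:
  assumes "x\<^sup>2 + y\<^sup>2 + z\<^sup>2 \<le> 1"
  shows "sqrt (((a - a') * x)\<^sup>2 + ((b - b') * y)\<^sup>2 + ((c - c') * z + t)\<^sup>2) \<le>
    channel_dist (shifted_diag_channel t a b c) (diag_channel a' b' c')"
proof -
  let ?g = "\<lambda>\<rho>. trace_norm (shifted_diag_channel t a b c \<rho> - diag_channel a' b' c' \<rho>)"
  have "?g \<rho> \<le> \<bar>a - a'\<bar> + \<bar>b - b'\<bar> + (\<bar>c - c'\<bar> + \<bar>t\<bar>)" if state: "qubit_state \<rho>" for \<rho>
  proof -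
    obtain x y z where \<rho>: "\<rho> = bloch_op (x, y, z)" and r: "x\<^sup>2 + y\<^sup>2 + z\<^sup>2 \<le> 1"
      using state by (rule qubit_state_exhaust)
    have "x\<^sup>2 \<le> 1" "y\<^sup>2 \<le> 1" "z\<^sup>2 \<le> 1"
      using r zero_le_power2[of x] zero_le_power2[of y] zero_le_power2[of z] by linarith+
    then have le: "\<bar>x\<bar> \<le> 1" "\<bar>y\<bar> \<le> 1" "\<bar>z\<bar> \<le> 1"
      by (simp_all add: abs_square_le_1)
    \<comment> \<open>The Euclidean length is at most the sum of the absolute values of the
      components.\<close>
    have "?g \<rho> \<le> \<bar>(a - a') * x\<bar> + \<bar>(b - b') * y\<bar> + \<bar>(c - c') * z + t\<bar>"
      unfolding \<rho> trace_norm_shifted_diag_diff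
      by (rule real_le_lsqrt) (auto simp: power2_eq_square algebra_simps)
    also have "\<dots> \<le> \<bar>a - a'\<bar> + \<bar>b - b'\<bar> + (\<bar>c - c'\<bar> + \<bar>t\<bar>)"
      using le mult_left_le[of "\<bar>x\<bar>" "\<bar>a - a'\<bar>"] mult_left_le[of "\<bar>y\<bar>" "\<bar>b - b'\<bar>"]
        mult_left_le[of "\<bar>z\<bar>" "\<bar>c - c'\<bar>"] abs_triangle_ineq[of "(c - c') * z" t]
      by (simp add: abs_mult)
    finally show ?thesis .
  qed
  then have bdd: "bdd_above (?g ` {\<rho>. qubit_state \<rho>})"
    by (intro bdd_aboveI2) auto
  show ?thesis
    unfolding channel_dist_def trace_norm_shifted_diag_diff[symmetric]
    by (rule cSUP_upper[OF _ bdd]) (simp add: qubit_state_bloch_op assms)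
qed

text \<open>The centre of the ball is fixed by every diagonal map, while the shifted one moves it by
  \<bar>t\<bar>.\<close>

lemma channel_dist_shifted_diag_lower:
  "\<bar>t\<bar> \<le> channel_dist (shifted_diag_channel t a b c) (diag_channel a' b' c')"
  using channel_dist_shifted_diag_ge[of 0 0 0 a a' b b' c c' t] by simp

lemma channel_dist_shifted_diag_unique:
  assumes "channel_dist (shifted_diag_channel t a b c) (diag_channel a' b' c') \<le> \<bar>t\<bar>"
  shows "a' = a \<and> b' = b \<and> c' = c"
proof -
  have le: "sqrt (((a - a') * x)\<^sup>2 + ((b - b') * y)\<^sup>2 + ((c - c') * z + t)\<^sup>2) \<le> \<bar>t\<bar>"
    if "x\<^sup>2 + y\<^sup>2 + z\<^sup>2 \<le> 1" for x y z
    using channel_dist_shifted_diag_ge[OF that] assms by (rule order_trans)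
  have sq: "((a - a') * x)\<^sup>2 + ((b - b') * y)\<^sup>2 + ((c - c') * z + t)\<^sup>2 \<le> t\<^sup>2"
    if "x\<^sup>2 + y\<^sup>2 + z\<^sup>2 \<le> 1" for x y z
    using le[OF that] by (simp flip: real_sqrt_abs)
  \<comment> \<open>On the equator the shift is orthogonal to the remaining difference, so any
    mismatch adds to \<open>t\<^sup>2\<close>.\<close>
  have "(a - a')\<^sup>2 \<le> 0" using sq[of 1 0 0] by simp
  moreover have "(b - b')\<^sup>2 \<le> 0" using sq[of 0 1 0] by simp
  \<comment> \<open>Adding the bounds at the two poles cancels the cross term
    \<open>2 * (c - c') * t\<close>.\<close>
  moreover have "(c - c')\<^sup>2 \<le> 0"
    using sq[of 0 0 1] sq[of 0 0 "- 1"] by (simp add: power2_eq_square algebra_simps)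
  ultimately show ?thesis by simp
qed

lemma closest_pauli_channel_shifted_diag:
  assumes pauli: "pauli_channel (diag_channel a b c)"
    and E: "same_channel E (shifted_diag_channel t a b c)"
  shows "closest_pauli_channel E P \<longleftrightarrow> same_channel P (diag_channel a b c)"
    and "channel_dist E (diag_channel a b c) = \<bar>t\<bar>"
proof -
  let ?D = "diag_channel a b c" and ?S = "shifted_diag_channel t a b c"
  have dist_E: "channel_dist E Q = channel_dist ?S Q" for Q
    unfolding channel_dist_def by (rule SUP_cong) (use E in \<open>auto simp: same_channel_def\<close>)
  show dist_D: "channel_dist E ?D = \<bar>t\<bar>"
    by (simp add: dist_E channel_dist_shifted_diag_same)
  have lower: "\<bar>t\<bar> \<le> channel_dist E Q" if "pauli_channel Q" for Q
    using pauli_channel_imp_diag[OF that]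
    by (metis dist_E same_channel_channel_dist channel_dist_shifted_diag_lower)
  show "closest_pauli_channel E P \<longleftrightarrow> same_channel P ?D"
  proof
    assume closest: "closest_pauli_channel E P"
    then obtain a' b' c' where P: "same_channel P (diag_channel a' b' c')"
      unfolding closest_pauli_channel_def by (metis pauli_channel_imp_diag)
    \<comment> \<open>\<open>?D\<close> is itself an admissible competitor, so a minimiser does at
      least as well and the uniqueness lemma applies.\<close>
    have "channel_dist E P \<le> \<bar>t\<bar>"
      using closest pauli dist_D unfolding closest_pauli_channel_def by metis
    then have "a' = a \<and> b' = b \<and> c' = c"
      using channel_dist_shifted_diag_unique dist_E same_channel_channel_dist[OF P] by metis
    then show "same_channel P ?D" using P by simp
  next
    assume P: "same_channel P ?D"
    then show "closest_pauli_channel E P"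
      using same_channel_pauli[OF P pauli] same_channel_channel_dist[OF P] dist_D lower
      by (simp add: closest_pauli_channel_def)
  qed
qed

section \<open>Application to the simulated channel\<close>

theorem proposition18:
  fixes \<eta> q1 q2 q3 f11 f22 f33 :: real
    and u :: nat
    and E_sim E_cl :: "qubit_op \<Rightarrow> qubit_op"
  assumes "u \<in> {0, 1}"
    and "\<eta> \<in> {0..1}"
    and "(q1, q2, q3) \<in> tetrahedron"
    and "E_sim = (unitary_channel sigma_x ^^ u) \<circ> amplitude_damping \<eta>
                   \<circ> pauli_with_params (q1, q2, q3)"
    and "(f11, f22, f33) =
           (if u = 0 then (sqrt (1 - \<eta>) * q1, - sqrt (1 - \<eta>) * q2, (1 - \<eta>) * q3)
            else (sqrt (1 - \<eta>) * q1, sqrt (1 - \<eta>) * q2, - (1 - \<eta>) * q3))"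
    and "E_cl = bloch_channel (\<lambda>(x, y, z). (f11 * x, f22 * y, f33 * z))"
  shows "(\<forall>P. closest_pauli_channel E_sim P \<longleftrightarrow> same_channel P E_cl)
         \<and> channel_dist E_sim E_cl = \<eta>"
proof -
  let ?s = "sqrt (1 - \<eta>)"
  define t where "t = (if u = 0 then \<eta> else - \<eta>)"
  note E_sim = assms(4) and E_cl = assms(6)
  have s: "0 \<le> ?s" "?s \<le> 1" and s2: "?s\<^sup>2 = 1 - \<eta>" and abs_t: "\<bar>t\<bar> = \<eta>"
    using assms(2) by (auto simp: t_def)
  \<comment> \<open>Written with \<open>- q2\<close> as a unit because the second Bloch multiplier
    of the Pauli channel is \<open>- q2\<close>.\<close>
  have q: "0 \<le> 1 + q1 + - q2 + q3" "0 \<le> 1 + q1 - - q2 - q3" "0 \<le> 1 - q1 + - q2 - q3"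
    "0 \<le> 1 - q1 - - q2 + q3"
    using tetrahedron_halfspaces[OF assms(3)] by simp_all
  have u: "u = 0 \<or> u = 1" using assms(1) by simp
  have f: "f11 = ?s * q1" "f22 = (if u = 0 then - ?s * q2 else ?s * q2)"
    "f33 = (if u = 0 then (1 - \<eta>) * q3 else - (1 - \<eta>) * q3)"
    using assms(5) by (auto split: if_splits)
  have E_cl': "E_cl = diag_channel f11 f22 f33"
    by (simp add: E_cl diag_channel_def)
  have pauli: "pauli_channel (diag_channel f11 f22 f33)"
  proof (cases "u = 0")
    case True
    then show ?thesis
      using pauli_channel_damped[OF q s] assms(5) by (simp add: s2)
  next
    case False
    \<comment> \<open>Composition with \<open>sigma_x\<close> negates the second and third
      multipliers, which only permutes the four face inequalities.\<close>
    have q': "0 \<le> 1 + q1 + q2 + - q3" "0 \<le> 1 + q1 - q2 - - q3" "0 \<le> 1 - q1 + q2 - - q3"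
      "0 \<le> 1 - q1 - q2 + - q3"
      using q by simp_all
    have "f11 = ?s * q1" "f22 = ?s * q2" "f33 = ?s\<^sup>2 * - q3"
      using assms(5) False by (simp_all add: s2 algebra_simps)
    then show ?thesis using pauli_channel_damped[OF q' s] by simp
  qed
  have "same_channel E_sim (shifted_diag_channel t f11 f22 f33)"
    unfolding same_channel_def
  proof (intro allI impI)
    fix \<rho> :: qubit_op
    assume "qubit_state \<rho>"
    then obtain x y z where \<rho>: "\<rho> = bloch_op (x, y, z)"
      by (blast elim: qubit_state_exhaust)
    show "E_sim \<rho> = shifted_diag_channel t f11 f22 f33 \<rho>"
      using u
      by (auto simp: \<rho> f E_sim pauli_with_params_def amplitude_damping_def t_def
          shifted_diag_channel_def unitary_channel_sigma_x_bloch_op bloch_op_inject algebra_simps)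
  qed
  from closest_pauli_channel_shifted_diag[OF pauli this] show ?thesis
    unfolding E_cl' abs_t by blast
qed

end
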